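(* Let $\mathcal{Q}$ be a thick finite generalized quadrangle of order $(s,t)$. If $s+1$ is a prime and if there exists a natural number $n$ such that \[ \frac{t^2}{n+1} + t \le s + 1 < \frac{t^2}{n},\] then $\mathcal{Q}$ does not have an automorphism of order $s+1$, and $\mathcal{Q}$ does not have a group of automorphisms that is transitive on its points.
   Context: Natural numbers are positive integers. A finite generalized quadrangle of order $(s,t)$, with $s,t$ positive integers, is an incidence structure consisting of a finite set $\mathcal{P}$ of points, a finite set $\mathcal{L}$ of lines disjoint from $\mathcal{P}$, and a symmetric point-line incidence relation such that: each point is incident with exactly $t+1$ lines and each line is incident with exactly $s+1$ points; two distinct points are mutually incident with at most one line, and two distinct lines are mutually incident with at most one point; and for each point $P$ and each line $\ell$ not incident with $P$ there is a unique pair $(P',\ell') \in \mathcal{P}\times\mathcal{L}$ such that $P$ is incident with $\ell'$, $\ell'$ is incident with $P'$, and $P'$ is incident with $\ell$. It is thick if $s>1$ and $t>1$. An automorphism of $\mathcal{Q}$ is a permutation of the point set that preserves collinearity (two points are collinear if some line is incident with both); it induces a permutation of the lines preserving incidence. The order of an automorphism is its order as an element of the automorphism group. *)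

theory Defs
  imports
    "HOL-Algebra.Group_Action"
    "HOL-Algebra.Multiplicative_Group"
    "HOL-Computational_Algebra.Primes"
begin

(* Points and lines live in separate types, so that the two sets are disjoint and the symmetric
   incidence relation is given by its point-line half.  Only the values of I on P \<times> L matter. *)

definition collinear :: "'l set \<Rightarrow> ('p \<Rightarrow> 'l \<Rightarrow> bool) \<Rightarrow> 'p \<Rightarrow> 'p \<Rightarrow> bool" where
  "collinear L I x y \<longleftrightarrow> (\<exists>l\<in>L. I x l \<and> I y l)"

(* Nonemptiness is implicit in the usual definition; without it the empty structure would be a
   generalized quadrangle of every order, with a vacuously transitive trivial group. *)

locale generalized_quadrangle =
  fixes P :: "'p set" and L :: "'l set" and I :: "'p \<Rightarrow> 'l \<Rightarrow> bool" and s t :: nat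
  assumes finite_points: "finite P"
    and finite_lines: "finite L"
    and points_nonempty: "P \<noteq> {}"
    and s_pos: "s > 0"
    and t_pos: "t > 0"
    and lines_through_point: "x \<in> P \<Longrightarrow> card {l \<in> L. I x l} = t + 1"
    and points_on_line: "l \<in> L \<Longrightarrow> card {x \<in> P. I x l} = s + 1"
    and at_most_one_line:
      "\<lbrakk>x \<in> P; y \<in> P; x \<noteq> y; l \<in> L; m \<in> L; I x l; I y l; I x m; I y m\<rbrakk> \<Longrightarrow> l = m"
    and at_most_one_point:
      "\<lbrakk>l \<in> L; m \<in> L; l \<noteq> m; x \<in> P; y \<in> P; I x l; I x m; I y l; I y m\<rbrakk> \<Longrightarrow> x = y"
    and unique_projection:
      "\<lbrakk>x \<in> P; l \<in> L; \<not> I x l\<rbrakk> \<Longrightarrow> \<exists>!(x', l'). x' \<in> P \<and> l' \<in> L \<and> I x l' \<and> I x' l' \<and> I x' l"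

locale thick_generalized_quadrangle = generalized_quadrangle +
  assumes s_gt_1: "s > 1" and t_gt_1: "t > 1"

definition aut_group :: "'p set \<Rightarrow> 'l set \<Rightarrow> ('p \<Rightarrow> 'l \<Rightarrow> bool) \<Rightarrow> ('p \<Rightarrow> 'p) monoid" where
  "aut_group P L I = (BijGroup P)
     \<lparr>carrier := {g \<in> Bij P. \<forall>x\<in>P. \<forall>y\<in>P. collinear L I x y \<longrightarrow> collinear L I (g x) (g y)}\<rparr>"

(* A permutation of a finite set that preserves a relation also reflects it, hence the
   one-directional condition above suffices for inverses to be automorphisms. *)

lemma group_aut_group:
  fixes P :: "'p set" and L :: "'l set"
  assumes fin: "finite P"
  shows "group (aut_group P L I)"
proof -
  let ?A = "{g \<in> Bij P. \<forall>x\<in>P. \<forall>y\<in>P. collinear L I x y \<longrightarrow> collinear L I (g x) (g y)}"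
  interpret B: group "BijGroup P" by (rule group_BijGroup)
  have "subgroup ?A (BijGroup P)"
  proof (rule B.subgroupI)
    show "?A \<subseteq> carrier (BijGroup P)" by (auto simp: BijGroup_def)
    show "?A \<noteq> {}" using id_Bij by fastforce
  next
    fix g assume g: "g \<in> ?A"
    then have gB: "g \<in> Bij P" and bij: "bij_betw g P P" by (auto simp: Bij_def)
    let ?C = "{(x, y) \<in> P \<times> P. collinear L I x y}"
    have "finite ?C" by (rule finite_subset[of _ "P \<times> P"]) (use fin in auto)
    moreover have "map_prod g g ` ?C \<subseteq> ?C" using g bij by (auto simp: bij_betw_def)
    moreover have "inj_on (map_prod g g) ?C"
      using bij by (auto simp: inj_on_def bij_betw_def)
    ultimately have eq: "map_prod g g ` ?C = ?C" by (rule endo_inj_surj)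
    have "collinear L I (inv_into P g x) (inv_into P g y)"
      if xy: "x \<in> P" "y \<in> P" "collinear L I x y" for x y
    proof -
      have "(x, y) \<in> map_prod g g ` ?C" using eq xy by blast
      then obtain u v where "u \<in> P" "v \<in> P" "collinear L I u v" "x = g u" "y = g v" by auto
      then show ?thesis using bij by (simp add: bij_betw_def)
    qed
    then have "(\<lambda>x\<in>P. inv_into P g x) \<in> ?A"
      using restrict_inv_into_Bij[OF gB] by simp
    then show "inv\<^bsub>BijGroup P\<^esub> g \<in> ?A" using inv_BijGroup[OF gB] by simp
  next
    fix g h assume g: "g \<in> ?A" and h: "h \<in> ?A"
    then have "g \<in> Bij P" "h \<in> Bij P" "h ` P \<subseteq> P" by (auto simp: Bij_def bij_betw_def)
    then show "g \<otimes>\<^bsub>BijGroup P\<^esub> h \<in> ?A"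
      using g h by (auto simp: BijGroup_def compose_Bij compose_eq image_subset_iff)
  qed
  then show ?thesis unfolding aut_group_def by (rule B.subgroup_imp_group)
qed

end

theory Submission
  imports Defs "HOL-Algebra.Sylow"
begin

text \<open>Let $p = s + 1$. The hypothesis on $n$ forces $t < s$. Suppose that an automorphism of order $p$
  exists. A fixed point would have its fewer than $p$ lines fixed, hence also the remaining
  $s < p$ points of each of those lines, and the fixed points would spread to the whole
  quadrangle (\<open>no_fixed_point\<close>). So no point is fixed, and therefore two fixed lines never
  meet. Counting lines in orbits modulo $p$, the number $F$ of fixed lines satisfies
  $F \equiv 1 - t^2$ modulo $p$ (\<open>fixed_lines_cong\<close>), and $F \neq 0$ because $p$ does not divide
  $(t - 1)(t + 1)$.

  On the other side $F$ cannot be large. If a line that is not fixed meets $a \geq 1$ fixed lines,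
  then the $p$ lines of its orbit are pairwise disjoint and all of them meet those $a$ fixed lines.
  Such a grid of $a$ by $s + 1$ lines satisfies $(a - 1) s \leq t^2$ (\<open>grid_bound\<close>), so
  $a - 1 \leq n$ by the hypothesis. A point on a fixed line is joined to each other fixed line by
  one of its $t$ remaining lines, hence $F \leq 1 + t n$ (\<open>card_fixed_lines_le\<close>). Thus
  $t^2 \leq F + t^2 - 1 \leq t^2 + t n$; the two inequalities in the hypothesis place this multiple
  of $p$ strictly between $n p$ and $(n + 1) p$, a contradiction.

  A group that is transitive on the $(s + 1)(s t + 1)$ points has order divisible by $p$ and so
  contains an element of order $p$, which has just been excluded.\<close>

section \<open>Counting in generalized quadrangles\<close>

text \<open>The Cauchy--Schwarz inequality against the constant function: expand the sum of the squares
  $(N c_z - S)^2$, where $N$ is the number of terms and $S$ their sum.\<close>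

lemma square_of_sum_le:
  fixes c :: "'a \<Rightarrow> nat"
  assumes "finite Z"
  shows "(\<Sum>z\<in>Z. c z)\<^sup>2 \<le> card Z * (\<Sum>z\<in>Z. (c z)\<^sup>2)"
proof (cases "Z = {}")
  case False
  define N S where "N = int (card Z)" and "S = (\<Sum>z\<in>Z. int (c z))"
  define Q where "Q = (\<Sum>z\<in>Z. (int (c z))\<^sup>2)"
  have N: "N > 0" unfolding N_def using assms False by (simp add: card_gt_0_iff)
  have "0 \<le> (\<Sum>z\<in>Z. (N * int (c z) - S)\<^sup>2)" by (simp add: sum_nonneg)
  also have "\<dots> = (\<Sum>z\<in>Z. N\<^sup>2 * (int (c z))\<^sup>2 - 2 * N * S * int (c z) + S\<^sup>2)"
    by (simp add: power2_eq_square algebra_simps)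
  also have "\<dots> = N\<^sup>2 * Q - 2 * N * S * S + N * S\<^sup>2"
    by (simp add: sum.distrib sum_subtractf sum_distrib_left[symmetric] N_def S_def Q_def)
  also have "\<dots> = N * (N * Q - S\<^sup>2)" by (simp add: power2_eq_square algebra_simps)
  finally have "S\<^sup>2 \<le> N * Q" using N by (simp add: zero_le_mult_iff)
  then have "int ((\<Sum>z\<in>Z. c z)\<^sup>2) \<le> int (card Z * (\<Sum>z\<in>Z. (c z)\<^sup>2))"
    by (simp add: N_def S_def Q_def)
  then show ?thesis by (simp only: of_nat_le_iff)
qed simp

context generalized_quadrangle
begin

definition meets :: "'l \<Rightarrow> 'l \<Rightarrow> bool" where
  "meets l m \<longleftrightarrow> (\<exists>x\<in>P. I x l \<and> I x m)"

text \<open>Such a set of lines is known as a partial spread.\<close>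

definition disjoint_lines :: "'l set \<Rightarrow> bool" where
  "disjoint_lines A \<longleftrightarrow> A \<subseteq> L \<and> (\<forall>l\<in>A. \<forall>m\<in>A. l \<noteq> m \<longrightarrow> \<not> meets l m)"

text \<open>The uniqueness half of the projection axiom, in the form in which it is mostly used: two paths
  from a point to a line not through it coincide.\<close>

lemma no_triangle:
  assumes "x \<in> P" "l \<in> L" "\<not> I x l"
    and "k \<in> L" "I x k" "y \<in> P" "I y k" "I y l"
    and "k' \<in> L" "I x k'" "y' \<in> P" "I y' k'" "I y' l"
  shows "k = k'" "y = y'"
  using unique_projection[of x l] assms by blast+

lemma projection:
  assumes "x \<in> P" "l \<in> L" "\<not> I x l"
  obtains y k where "y \<in> P" "k \<in> L" "I x k" "I y k" "I y l"
  using unique_projection[OF assms] by blast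

lemma lines_nonempty: "L \<noteq> {}"
proof -
  obtain x where "x \<in> P" using points_nonempty by blast
  then have "card {l \<in> L. I x l} \<noteq> 0" using lines_through_point by simp
  then show ?thesis by fastforce
qed

text \<open>Exchanging points and lines exchanges $s$ and $t$. The point count below then also counts lines.\<close>

lemma dual: "generalized_quadrangle L P (\<lambda>l x. I x l) t s"
proof
  fix l x assume "l \<in> L" "x \<in> P" "\<not> I x l"
  then have ex: "\<exists>!(y, k). y \<in> P \<and> k \<in> L \<and> I x k \<and> I y k \<and> I y l" by (intro unique_projection)
  then obtain y k where "y \<in> P" "k \<in> L" "I x k" "I y k" "I y l" by blast
  with ex show "\<exists>!(k, y). k \<in> L \<and> y \<in> P \<and> I y l \<and> I y k \<and> I x k"
    by (intro ex1I[of _ "(k, y)"]) blast+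
next
  fix l m x y
  assume "l \<in> L" "m \<in> L" "l \<noteq> m" "x \<in> P" "y \<in> P" "I x l" "I x m" "I y l" "I y m"
  then show "x = y" by (rule at_most_one_point)
next
  fix x y l m
  assume "x \<in> P" "y \<in> P" "x \<noteq> y" "l \<in> L" "m \<in> L" "I x l" "I y l" "I x m" "I y m"
  then show "l = m" by (rule at_most_one_line)
qed (simp_all add: finite_points finite_lines lines_nonempty s_pos t_pos lines_through_point
      points_on_line)

text \<open>Fix a line $l$ and let $M$ be the set of lines meeting $l$ in one point. Counting flags on $l$
  gives $(s + 1) t$ lines in $M$, and each point off $l$ lies on exactly one line in $M$.\<close>

lemma card_points: "card P = (s + 1) * (s * t + 1)"
proof -
  obtain l where l: "l \<in> L" using lines_nonempty by blast
  define M where "M = {m \<in> L. m \<noteq> l \<and> meets m l}"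
  define S R where "S = {x \<in> P. I x l}" and "R = {x \<in> P. \<not> I x l}"
  have fin: "finite M" "finite S" "finite R"
    using finite_lines finite_points by (auto simp: M_def S_def R_def)
  have one: "card {x \<in> S. I x m} = 1" if m: "m \<in> M" for m
  proof -
    obtain x where "x \<in> P" "I x m" "I x l" using m by (auto simp: M_def meets_def)
    then have "{x \<in> S. I x m} = {x}"
      using at_most_one_point[of m l] m l by (auto simp: M_def S_def)
    then show ?thesis by simp
  qed
  have "(\<Sum>x\<in>S. card {m \<in> M. I x m}) = 1 * card M"
    using one fin by (intro sum_multicount) auto
  moreover have "card {m \<in> M. I x m} = t" if x: "x \<in> S" for x
  proof -
    have "{m \<in> M. I x m} = {m \<in> L. I x m} - {l}"
      using x by (auto simp: M_def S_def meets_def)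
    then show ?thesis using x l lines_through_point[of x] by (simp add: S_def)
  qed
  ultimately have cM: "card M = (s + 1) * t"
    using points_on_line[OF l] by (simp add: S_def)
  have "(\<Sum>x\<in>R. card {m \<in> M. I x m}) = s * card M"
  proof (intro sum_multicount ballI)
    fix m assume m: "m \<in> M"
    have "{x \<in> R. I x m} = {x \<in> P. I x m} - {x \<in> S. I x m}"
      by (auto simp: R_def S_def)
    then have "card {x \<in> R. I x m} = card {x \<in> P. I x m} - card {x \<in> S. I x m}"
      using fin by (metis (no_types, lifting) S_def card_Diff_subset finite_subset mem_Collect_eq subsetI)
    then show "card {x \<in> R. I x m} = s"
      using one[OF m] points_on_line[of m] m by (simp add: M_def)
  qed (use fin in auto)
  moreover have "card {m \<in> M. I x m} = 1" if x: "x \<in> R" for x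
  proof -
    obtain y k where k: "y \<in> P" "k \<in> L" "I x k" "I y k" "I y l"
      using projection[of x l] x l by (auto simp: R_def)
    have "m = k" if m: "m \<in> M" "I x m" for m
    proof -
      obtain y' where "y' \<in> P" "I y' m" "I y' l" using m by (auto simp: M_def meets_def)
      then show ?thesis using no_triangle(1)[of x l m y' k y] x l k m by (simp add: M_def R_def)
    qed
    moreover have "k \<in> M" using k x by (auto simp: M_def R_def meets_def)
    ultimately have "{m \<in> M. I x m} = {k}" using k by blast
    then show ?thesis by simp
  qed
  ultimately have cR: "card R = s * card M" by simp
  have "P = S \<union> R" "S \<inter> R = {}" by (auto simp: S_def R_def)
  then have "card P = card S + card R" using fin by (simp add: card_Un_disjoint)
  then show ?thesis using cM cR points_on_line[OF l] by (simp add: S_def algebra_simps)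
qed

lemma card_lines: "card L = (t + 1) * (s * t + 1)"
  using generalized_quadrangle.card_points[OF dual] by (simp add: mult.commute)

lemma card_points_of_disjoint_lines:
  assumes "disjoint_lines A"
  shows "card {x \<in> P. \<exists>m\<in>A. I x m} = card A * (s + 1)"
proof -
  let ?U = "{x \<in> P. \<exists>m\<in>A. I x m}"
  have A: "A \<subseteq> L" "finite A"
    using assms finite_lines by (auto simp: disjoint_lines_def intro: finite_subset)
  have "(\<Sum>x\<in>?U. card {m \<in> A. I x m}) = (s + 1) * card A"
  proof (intro sum_multicount ballI)
    fix m assume m: "m \<in> A"
    then have "{x \<in> ?U. I x m} = {x \<in> P. I x m}" by auto
    then show "card {x \<in> ?U. I x m} = s + 1" using points_on_line m A by auto
  qed (use A finite_points in auto)
  moreover have "card {m \<in> A. I x m} = 1" if x: "x \<in> ?U" for x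
  proof -
    obtain m where m: "m \<in> A" "I x m" using x by blast
    have "{m \<in> A. I x m} = {m}"
      using assms x m by (auto simp: disjoint_lines_def meets_def)
    then show ?thesis by simp
  qed
  ultimately show ?thesis by (simp add: mult.commute)
qed

text \<open>The $s + 1$ pairwise disjoint lines of $B$ meet a line of $A$ in distinct points, which are then
  all of its $s + 1$ points.\<close>

lemma point_of_grid_on_both:
  assumes A: "A \<subseteq> L" and B: "disjoint_lines B" "card B = s + 1"
    and grid: "\<And>m b. m \<in> A \<Longrightarrow> b \<in> B \<Longrightarrow> meets m b"
    and x: "x \<in> P" "m \<in> A" "I x m"
  shows "\<exists>b\<in>B. I x b"
proof -
  define h where "h b = (SOME y. y \<in> P \<and> I y m \<and> I y b)" for b
  have h: "h b \<in> P \<and> I (h b) m \<and> I (h b) b" if "b \<in> B" for b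
    unfolding h_def by (rule someI_ex) (use grid[OF x(2) that] in \<open>auto simp: meets_def\<close>)
  have "inj_on h B"
  proof (rule inj_onI)
    fix b b' assume "b \<in> B" "b' \<in> B" "h b = h b'"
    then show "b = b'" using h[of b] h[of b'] B(1) by (auto simp: disjoint_lines_def meets_def)
  qed
  then have "card (h ` B) = card {y \<in> P. I y m}"
    using B points_on_line[of m] x A by (auto simp: card_image)
  moreover have "h ` B \<subseteq> {y \<in> P. I y m}" using h by blast
  ultimately have "h ` B = {y \<in> P. I y m}"
    using finite_points by (intro card_subset_eq) auto
  then obtain b where "b \<in> B" "x = h b" using x by blast
  then show ?thesis using h by blast
qed

end

context thick_generalized_quadrangle
begin

text \<open>Write $U$ for the points on lines of $A$, which also lie on lines of $B$, $W$ for the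
  remaining points on lines of $B$, and $Z$ for the lines that avoid $U$. The number of lines in
  $Z$ is bounded because a line outside $A$ and $B$ contains at most one point of $U$. A line $z$
  of $Z$ contains $c_z$ points of $W$; the sum of the $c_z$ is known exactly and the sum of their
  squares is bounded above, since a line of $Z$ through a point of $W$ is determined by any
  further line of $B$ that it meets. Cauchy--Schwarz over $Z$ turns these three facts into the
  inequality. This is the dual, for one set of full size $s + 1$, of the inequality of Payne and
  Thas that $(m - 1)(n - 1) \leq s^2$ whenever disjoint sets of $m$ and $n$ pairwise noncollinear
  points are completely joined.\<close>

lemma grid_bound:
  assumes A: "disjoint_lines A" "A \<noteq> {}" and B: "disjoint_lines B" "card B = s + 1"
    and AB: "A \<inter> B = {}"
    and grid: "\<And>m b. m \<in> A \<Longrightarrow> b \<in> B \<Longrightarrow> meets m b"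
  shows "(card A - 1) * s \<le> t\<^sup>2"
proof -
  define a where "a = card A"
  define U where "U = {x \<in> P. \<exists>m\<in>A. I x m}"
  define V where "V = {x \<in> P. \<exists>b\<in>B. I x b}"
  define W where "W = V - U"
  define Z where "Z = {z \<in> L. \<forall>x\<in>U. \<not> I x z}"
  define c where "c z = card {x \<in> W. I x z}" for z
  have AL: "A \<subseteq> L" and BL: "B \<subseteq> L" using A B by (auto simp: disjoint_lines_def)
  have finAB: "finite A" "finite B" using AL BL finite_lines by (auto intro: finite_subset)
  have fin: "finite U" "finite V" "finite W" "finite Z"
    using finite_points finite_lines by (auto simp: U_def V_def W_def Z_def)
  have a: "a \<ge> 1" using A finAB by (simp add: a_def Suc_le_eq card_gt_0_iff)
  have UV: "U \<subseteq> V"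
    using point_of_grid_on_both[OF AL B grid] by (auto simp: U_def V_def)
  have cU: "card U = a * (s + 1)"
    using card_points_of_disjoint_lines[OF A(1)] by (simp add: U_def a_def)
  have cV: "card V = (s + 1) * (s + 1)"
    using card_points_of_disjoint_lines[OF B(1)] B(2) by (simp add: V_def)
  have a_le: "a \<le> s + 1"
    using card_mono[OF fin(2) UV] unfolding cU cV by (simp only: mult_le_cancel2)
  have cW: "card W = (s + 1) * (s + 1 - a)"
    using card_Diff_subset[OF fin(1) UV] cU cV
    by (simp add: W_def diff_mult_distrib2 mult.commute del: mult_Suc mult_Suc_right)
  \<comment> \<open>By uniqueness of the projection, the line of \<open>B\<close> through a point is the only one that joins it
          to a line of \<open>A\<close> not through it.\<close>
  have B_transversal: "l = b"
    if tr: "x \<in> P" "b \<in> B" "I x b" "m \<in> A" "\<not> I x m" "l \<in> L" "I x l" "y \<in> P" "I y l" "I y m"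
    for x b m l y
  proof -
    obtain y' where "y' \<in> P" "I y' m" "I y' b" using grid[of m b] tr by (auto simp: meets_def)
    then show ?thesis using no_triangle(1)[of x m l y b y'] tr AL BL by blast
  qed
  have B_notin_Z: "b \<notin> Z" if "b \<in> B" for b
    using A(2) grid[OF _ that] by (fastforce simp: Z_def U_def meets_def)

  have Z_bound: "card Z + a * (s + 1) * (t + 1) \<le> card L + s * a + (a - 1) * (s + 1)"
  proof -
    \<comment> \<open>The right-hand side charges 1 to each line that hits \<open>U\<close> and
          adds the surplus that lines of \<open>A\<close> and \<open>B\<close> can have.\<close>
    have few: "card {x \<in> U. I x l} \<le>
        (if l \<in> L - Z then 1 else 0) + (if l \<in> A then s else 0) + (if l \<in> B then a - 1 else 0)"
      if l: "l \<in> L" for l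
    proof -
      consider "l \<in> Z" | "l \<in> A" "l \<notin> Z" | "l \<in> B" "l \<notin> Z" | "l \<notin> Z" "l \<notin> A" "l \<notin> B" by blast
      then show ?thesis
      proof cases
        case 1
        then have "{x \<in> U. I x l} = {}" by (auto simp: Z_def)
        then show ?thesis by (simp only: card.empty le0)
      next
        case 2
        have "card {x \<in> U. I x l} \<le> card {x \<in> P. I x l}"
          using finite_points by (intro card_mono) (auto simp: U_def)
        then show ?thesis using points_on_line[OF l] 2 l by simp
      next
        case 3
        have "\<forall>x\<in>U. \<exists>m. m \<in> A \<and> I x m" by (auto simp: U_def)
        then obtain h where h: "\<And>x. x \<in> U \<Longrightarrow> h x \<in> A \<and> I x (h x)" by metis
        have "inj_on h {x \<in> U. I x l}"
        proof (rule inj_onI)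
          fix x y assume xy: "x \<in> {x \<in> U. I x l}" "y \<in> {x \<in> U. I x l}" "h x = h y"
          have "h x \<noteq> l" using h[of x] xy 3 AB by blast
          then show "x = y"
            using at_most_one_point[of "h x" l x y] h[of x] h[of y] xy AL l by (auto simp: U_def)
        qed
        then have "card {x \<in> U. I x l} \<le> a"
          unfolding a_def using h finAB by (intro card_inj_on_le[of h]) auto
        then show ?thesis using 3 l a by simp
      next
        case 4
        have "x = y" if xy: "x \<in> U" "I x l" "y \<in> U" "I y l" for x y
        proof (rule ccontr)
          assume ne: "x \<noteq> y"
          obtain m where m: "m \<in> A" "I y m" using xy by (auto simp: U_def)
          have "\<not> I x m"
            using at_most_one_line[of x y l m] ne xy m 4 l AL by (auto simp: U_def)
          moreover obtain b where "b \<in> B" "I x b" using xy UV by (auto simp: V_def)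
          ultimately show False using B_transversal[of x b m l y] xy m l 4 by (auto simp: U_def)
        qed
        then have "card {x \<in> U. I x l} \<le> 1" using fin by (auto simp: card_le_Suc0_iff_eq)
        then show ?thesis using 4 l by simp
      qed
    qed
    have "(\<Sum>l\<in>L. card {x \<in> U. I x l}) = (t + 1) * card U"
      using fin finite_lines lines_through_point by (intro sum_multicount) (auto simp: U_def)
    moreover have "(\<Sum>l\<in>L. card {x \<in> U. I x l}) \<le> (\<Sum>l\<in>L. (if l \<in> L - Z then 1 else 0) +
        (if l \<in> A then s else 0) + (if l \<in> B then a - 1 else 0))"
      by (intro sum_mono few)
    moreover have "\<dots> = card (L - Z) + s * a + (a - 1) * (s + 1)"
    proof -
      have "{l. l \<in> L \<and> l \<notin> Z} = L - Z" "L \<inter> A = A" "L \<inter> B = B" using AL BL by auto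
      then show ?thesis
        using finite_lines B(2) by (simp add: sum.distrib sum.If_cases a_def Int_absorb1 Int_def)
    qed
    moreover have "card (L - Z) + card Z = card L"
    proof -
      have "Z \<subseteq> L" by (auto simp: Z_def)
      then show ?thesis using card_mono[OF finite_lines] by (simp add: card_Diff_subset fin)
    qed
    ultimately show ?thesis using cU by (simp add: algebra_simps)
  qed

  have sum_c: "(\<Sum>z\<in>Z. c z) = t * card W"
    and deg_W: "\<And>x. x \<in> W \<Longrightarrow> card {z \<in> Z. I x z} = t"
  proof -
    show *: "card {z \<in> Z. I x z} = t" if x: "x \<in> W" for x
    proof -
      obtain b where b: "b \<in> B" "I x b" and xP: "x \<in> P" using x by (auto simp: W_def V_def)
      have "{z \<in> Z. I x z} = {l \<in> L. I x l} - {b}"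
      proof (intro equalityI subsetI)
        fix l assume "l \<in> {z \<in> Z. I x z}"
        then show "l \<in> {l \<in> L. I x l} - {b}" using B_notin_Z b by (auto simp: Z_def)
      next
        fix l assume l: "l \<in> {l \<in> L. I x l} - {b}"
        have "\<not> I y l" if "y \<in> U" for y
          using B_transversal[of x b _ l y] l b xP x that by (auto simp: W_def U_def)
        then show "l \<in> {z \<in> Z. I x z}" using l by (auto simp: Z_def)
      qed
      then show ?thesis using lines_through_point[OF xP] b BL by auto
    qed
    show "(\<Sum>z\<in>Z. c z) = t * card W"
      unfolding c_def using * fin by (intro sum_multicount) auto
  qed

  have sum_c2: "(\<Sum>z\<in>Z. (c z)\<^sup>2) \<le> card W * (s + t)"
  proof -
    have "(\<Sum>z\<in>{z \<in> Z. I x z}. c z) \<le> s + t" if x: "x \<in> W" for x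
    proof -
      obtain b where b: "b \<in> B" "I x b" and xP: "x \<in> P" using x by (auto simp: W_def V_def)
      \<comment> \<open>\<open>Y\<close>: the points of \<open>W\<close> joined to \<open>x\<close> by a line of \<open>Z\<close>. They lie on
          distinct lines of \<open>B\<close>, none of which is the one through \<open>x\<close>.\<close>
      define Y where "Y = {y \<in> W - {x}. \<exists>z\<in>Z. I x z \<and> I y z}"
      have finY: "finite Y" using fin by (simp add: Y_def)
      have "c z = Suc (card {y \<in> Y. I y z})" if z: "z \<in> Z" "I x z" for z
      proof -
        have "{y \<in> W. I y z} = insert x {y \<in> Y. I y z}" using x z by (auto simp: Y_def)
        moreover have "x \<notin> Y" by (simp add: Y_def)
        ultimately show ?thesis using finY by (simp add: c_def)
      qed
      then have "(\<Sum>z\<in>{z \<in> Z. I x z}. c z) = (\<Sum>z\<in>{z \<in> Z. I x z}. 1 + card {y \<in> Y. I y z})"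
        by (intro sum.cong) auto
      also have "\<dots> = t + (\<Sum>z\<in>{z \<in> Z. I x z}. card {y \<in> Y. I y z})"
        using deg_W[OF x] by (simp add: sum_Suc)
      also have "(\<Sum>z\<in>{z \<in> Z. I x z}. card {y \<in> Y. I y z}) = 1 * card Y"
      proof (intro sum_multicount ballI)
        fix y assume y: "y \<in> Y"
        then obtain z where z: "z \<in> Z" "I x z" "I y z" by (auto simp: Y_def)
        have "{z \<in> {z \<in> Z. I x z}. I y z} = {z}"
          using at_most_one_line[of x y _ z] y z xP by (auto simp: Y_def Z_def W_def V_def)
        then show "card {z \<in> {z \<in> Z. I x z}. I y z} = 1" by simp
      qed (use fin finY in auto)
      also have "card Y \<le> s"
      proof -
        have "\<forall>y\<in>Y. \<exists>b. b \<in> B \<and> I y b" by (auto simp: Y_def W_def V_def)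
        then obtain h where h: "\<And>y. y \<in> Y \<Longrightarrow> h y \<in> B \<and> I y (h y)" by metis
        have off: "\<not> I x (h y)" if y: "y \<in> Y" for y
        proof
          assume "I x (h y)"
          moreover obtain z where "z \<in> Z" "I x z" "I y z" using y by (auto simp: Y_def)
          ultimately have "h y = z" using at_most_one_line[of x y "h y" z] h[OF y] y BL xP
            by (auto simp: Y_def Z_def W_def V_def)
          then show False using B_notin_Z h[OF y] \<open>z \<in> Z\<close> by blast
        qed
        have "inj_on h Y"
        proof (rule inj_onI)
          fix y y' assume yy: "y \<in> Y" "y' \<in> Y" "h y = h y'"
          obtain z z' where "z \<in> Z" "I x z" "I y z" "z' \<in> Z" "I x z'" "I y' z'"
            using yy by (auto simp: Y_def)
          then show "y = y'"
            using no_triangle(2)[of x "h y" z y z' y'] xP off[OF yy(1)] h[OF yy(1)] h[OF yy(2)] yy BL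
            by (auto simp: Y_def Z_def W_def V_def)
        qed
        moreover have "h ` Y \<subseteq> B - {b}" using h off b by blast
        ultimately have "card Y \<le> card (B - {b})" using finAB by (intro card_inj_on_le) auto
        then show ?thesis using B(2) b by simp
      qed
      finally show ?thesis by simp
    qed
    then have "(\<Sum>x\<in>W. \<Sum>z\<in>{z \<in> Z. I x z}. c z) \<le> card W * (s + t)"
      using sum_bounded_above[of W "\<lambda>x. \<Sum>z\<in>{z \<in> Z. I x z}. c z" "s + t"] by simp
    moreover have "(\<Sum>z\<in>Z. (c z)\<^sup>2) = (\<Sum>z\<in>Z. \<Sum>x\<in>{x \<in> W. I x z}. c z)"
      by (simp add: c_def power2_eq_square)
    ultimately show ?thesis using sum.swap_restrict[OF fin(4) fin(3), of "\<lambda>z x. c z" "\<lambda>z x. I x z"]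
      by simp
  qed

  \<comment> \<open>The remaining estimates hold in the integers, where both cases end with a nonnegative
          multiple of \<open>s (t - 1)\<close>.\<close>
  define q N where "q = int a - 1" and "N = int (card Z)"
  have q: "0 \<le> q" "q \<le> int s" using a a_le by (auto simp: q_def)
  have N: "N \<le> int s * (int t)\<^sup>2 - q * (int s * int t - int s + int t)"
  proof -
    have "int (card Z + a * (s + 1) * (t + 1)) \<le> int (card L + s * a + (a - 1) * (s + 1))"
      using Z_bound by (simp only: of_nat_le_iff)
    then have "N + int a * (int s + 1) * (int t + 1) \<le>
        (int t + 1) * (int s * int t + 1) + int s * int a + (int a - 1) * (int s + 1)"
      using a by (simp only: card_lines N_def of_nat_diff of_nat_add of_nat_mult of_nat_1)
    then show ?thesis by (simp add: q_def power2_eq_square algebra_simps)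
  qed
  have pos: "0 < int s * (int t - 1)" using t_gt_1 s_gt_1 by simp
  have "q * int s \<le> (int t)\<^sup>2"
  proof (cases "card W = 0")
    \<comment> \<open>Here \<open>W\<close> is empty and Cauchy--Schwarz says nothing. Then the grid is an
          \<open>(s + 1)\<close> by \<open>(s + 1)\<close> subquadrangle, and \<open>s \<le> t\<close> because \<open>Z\<close> has nonnegative size.\<close>
    case True
    then have qs: "q = int s" using cW a_le by (simp add: q_def)
    have "0 \<le> int s * (int t)\<^sup>2 - int s * (int s * int t - int s + int t)"
      using N qs by (simp add: N_def)
    also have "\<dots> = int s * (int t - 1) * (int t - int s)"
      by (simp add: power2_eq_square algebra_simps)
    finally have "0 \<le> int t - int s" by (metis pos mult_le_cancel_left_pos mult_zero_right)
    then have "int s \<le> int t" by simp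
    then show ?thesis using qs by (simp add: power2_eq_square mult_mono)
  next
    case False
    have "(t * card W)\<^sup>2 \<le> card Z * (card W * (s + t))"
      using square_of_sum_le[OF fin(4), of c] sum_c sum_c2 by (metis le_trans mult_le_mono2)
    then have "card W * (t\<^sup>2 * card W) \<le> card W * (card Z * (s + t))"
      by (simp add: power2_eq_square algebra_simps)
    then have "t\<^sup>2 * card W \<le> card Z * (s + t)" using False by simp
    then have "int (t\<^sup>2 * card W) \<le> int (card Z * (s + t))" by (simp only: of_nat_le_iff)
    then have "(int t)\<^sup>2 * ((int s + 1) * (int s - q)) \<le> N * (int s + int t)"
    proof -
      have "int (s + 1 - a) = int s - q" using a_le by (simp add: q_def of_nat_diff)
      with \<open>int (t\<^sup>2 * card W) \<le> _\<close> show ?thesis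
        by (simp only: cW N_def of_nat_add of_nat_mult of_nat_power of_nat_1)
    qed
    also have "\<dots> \<le> (int s * (int t)\<^sup>2 - q * (int s * int t - int s + int t)) * (int s + int t)"
      by (intro mult_right_mono N) simp
    finally have "0 \<le> (int s * (int t - 1)) * ((int t)\<^sup>2 - q * int s)"
      by (simp add: power2_eq_square algebra_simps)
    then have "0 \<le> (int t)\<^sup>2 - q * int s"
      by (metis pos mult_le_cancel_left_pos mult_zero_right)
    then show ?thesis by simp
  qed
  then have "int ((a - 1) * s) \<le> int (t\<^sup>2)" using a by (simp add: q_def of_nat_diff)
  then show ?thesis by (simp only: of_nat_le_iff a_def)
qed

end

section \<open>Maps of prime period\<close>

lemma funpow_fixed: "f x = x \<Longrightarrow> (f ^^ i) x = x"
  by (induction i) auto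

text \<open>If two iterates with indices $i < j < p$ agreed, then $x$ would have the periods $p$ and
  $d = j - i$, which are coprime, and a Bezout identity $d u = p v + 1$ would make $x$ fixed.\<close>

lemma iterates_distinct:
  fixes f :: "'a \<Rightarrow> 'a"
  assumes p: "prime p" and fp: "(f ^^ p) x = x" and ne: "f x \<noteq> x"
  shows "inj_on (\<lambda>i. (f ^^ i) x) {..<p}"
proof (rule linorder_inj_onI)
  fix i j assume ij: "i < j" "i \<in> {..<p}" "j \<in> {..<p}"
  show "(f ^^ i) x \<noteq> (f ^^ j) x"
  proof
    assume eq: "(f ^^ i) x = (f ^^ j) x"
    define d where "d = j - i"
    have "(f ^^ (p - i + i)) x = (f ^^ (p - i + j)) x" using eq by (simp only: funpow_add o_apply)
    moreover have "p - i + i = p" "p - i + j = d + p" using ij by (auto simp: d_def)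
    ultimately have d: "(f ^^ d) x = x" using fp by (simp add: funpow_add)
    have "0 < d" "d < p" using ij by (auto simp: d_def)
    then have "coprime d p" using p by (metis coprime_commute dvd_imp_le not_le prime_imp_coprime)
    moreover have "p \<noteq> 1" using p by auto
    ultimately obtain u v where uv: "d * u = p * v + 1" using coprime_bezout_strong by blast
    have "(f ^^ (d * u)) x = x" using funpow_mod_eq[OF d, of "d * u"] by simp
    moreover have "(p * v + 1) mod p = 1"
      using prime_gt_1_nat[OF p] by (simp add: mod_Suc)
    then have "(f ^^ (p * v + 1)) x = f x" using funpow_mod_eq[OF fp, of "p * v + 1"]
      by simp
    ultimately show False using uv ne by simp
  qed
qed (use linorder_linear in blast)

lemma funpow_closed:
  assumes "f ` X \<subseteq> X" "x \<in> X"
  shows "(f ^^ i) x \<in> X"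
  using assms by (induction i) auto

lemma fixed_if_few:
  assumes p: "prime p" and X: "finite X" "f ` X \<subseteq> X" "card X < p"
    and fp: "\<And>x. x \<in> X \<Longrightarrow> (f ^^ p) x = x" and x: "x \<in> X"
  shows "f x = x"
proof (rule ccontr)
  assume "f x \<noteq> x"
  then have "card ((\<lambda>i. (f ^^ i) x) ` {..<p}) = p"
    using iterates_distinct[OF p fp[OF x]] by (simp add: card_image)
  moreover have "(\<lambda>i. (f ^^ i) x) ` {..<p} \<subseteq> X" using funpow_closed[OF X(2) x] by auto
  ultimately show False using X card_mono by (metis not_le)
qed

text \<open>The moved points fall into orbits of size $p$; the induction removes one orbit at a time.\<close>

lemma prime_dvd_card_moved:
  assumes p: "prime p" and "finite X" and "f ` X \<subseteq> X"
    and "\<And>x. x \<in> X \<Longrightarrow> (f ^^ p) x = x"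
  shows "p dvd card {x \<in> X. f x \<noteq> x}"
  using assms(2-)
proof (induction X rule: finite_psubset_induct)
  case (psubset X)
  show ?case
  proof (cases "\<forall>x\<in>X. f x = x")
    case True
    then have "{x \<in> X. f x \<noteq> x} = {}" by blast
    then show ?thesis by (metis card.empty dvd_0_right)
  next
    case False
    then obtain x where x: "x \<in> X" "f x \<noteq> x" by blast
    define C where "C = (\<lambda>i. (f ^^ i) x) ` {..<p}"
    have fx: "(f ^^ p) x = x" using psubset.prems x by blast
    have p0: "p > 0" using p prime_gt_0_nat by blast
    have iter_C: "(f ^^ i) x \<in> C" for i
      unfolding C_def using funpow_mod_eq[OF fx, of i] p0
      by (metis imageI lessThan_iff mod_less_divisor)
    have CX: "C \<subseteq> X" using funpow_closed[OF psubset.prems(1) x(1)] by (auto simp: C_def)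
    have cC: "card C = p"
      unfolding C_def using iterates_distinct[OF p fx x(2)] by (simp add: card_image)
    have C_moved: "f y \<noteq> y" if y: "y \<in> C" for y
    proof
      assume fy: "f y = y"
      obtain i where i: "i < p" "y = (f ^^ i) x" using y by (auto simp: C_def)
      have "(f ^^ (p - i)) y = y" using fy by (rule funpow_fixed)
      moreover have "(f ^^ (p - i)) y = x" using i fx by (metis comp_apply funpow_add le_add_diff_inverse2 less_imp_le)
      ultimately show False using fy x by simp
    qed
    have closed: "f ` (X - C) \<subseteq> X - C"
    proof clarify
      fix y assume y: "y \<in> X" "y \<notin> C"
      have "f y \<notin> C"
      proof
        assume "f y \<in> C"
        then obtain i where "f y = (f ^^ i) x" by (auto simp: C_def)
        then have "(f ^^ (p - 1)) (f y) = (f ^^ (p - 1 + i)) x" by (simp add: funpow_add)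
        moreover have "(f ^^ (p - 1)) (f y) = (f ^^ p) y"
          using p0 by (metis Suc_diff_1 comp_apply funpow_Suc_right)
        ultimately have "y \<in> C" using iter_C psubset.prems(2)[OF y(1)] by metis
        then show False using y by blast
      qed
      then show "f y \<in> X - C" using psubset.prems y by blast
    qed
    have "X - C \<subset> X" using x iter_C[of 0] by auto
    then have "p dvd card {y \<in> X - C. f y \<noteq> y}"
      using psubset.IH[of "X - C"] closed psubset.prems by blast
    moreover have "{y \<in> X. f y \<noteq> y} = {y \<in> X - C. f y \<noteq> y} \<union> C" using C_moved CX by blast
    then have "card {y \<in> X. f y \<noteq> y} = card {y \<in> X - C. f y \<noteq> y} + card C"
      using psubset.hyps CX by (simp add: card_Un_disjoint finite_subset disjoint_iff)
    ultimately show ?thesis using cC by simp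
  qed
qed

section \<open>Collineations of prime period $s + 1$\<close>

text \<open>A nontrivial collineation of prime period $s + 1$ is given by its actions \<open>f\<close> on points
  and \<open>\<phi>\<close> on lines, so that both can be iterated without referring to a group.\<close>

locale prime_collineation = thick_generalized_quadrangle +
  fixes f :: "'a \<Rightarrow> 'a" and \<phi> :: "'b \<Rightarrow> 'b"
  assumes prime: "prime (s + 1)"
    and f_closed: "f ` P \<subseteq> P" and \<phi>_closed: "\<phi> ` L \<subseteq> L"
    and incident: "\<lbrakk>x \<in> P; l \<in> L; I x l\<rbrakk> \<Longrightarrow> I (f x) (\<phi> l)"
    and f_period: "x \<in> P \<Longrightarrow> (f ^^ (s + 1)) x = x"
    and \<phi>_period: "l \<in> L \<Longrightarrow> (\<phi> ^^ (s + 1)) l = l"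
    and moved: "\<exists>x\<in>P. f x \<noteq> x"
    and t_less_s: "t < s"
begin

lemma f_inj: "\<lbrakk>x \<in> P; y \<in> P; f x = f y\<rbrakk> \<Longrightarrow> x = y"
  by (metis Suc_eq_plus1 comp_apply f_period funpow_Suc_right)

lemma f_iter_closed: "x \<in> P \<Longrightarrow> (f ^^ i) x \<in> P"
  using funpow_closed[OF f_closed] .

lemma \<phi>_iter_closed: "l \<in> L \<Longrightarrow> (\<phi> ^^ i) l \<in> L"
  using funpow_closed[OF \<phi>_closed] .

lemma iter_incident:
  assumes "x \<in> P" "l \<in> L" "I x l"
  shows "I ((f ^^ i) x) ((\<phi> ^^ i) l)"
  using assms by (induction i) (auto intro: incident f_iter_closed \<phi>_iter_closed)

text \<open>The $t + 1 < s + 1$ lines through the point are too few for an orbit of size $s + 1$.\<close>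

lemma line_through_fixed_point_fixed:
  assumes "x \<in> P" "f x = x" "l \<in> L" "I x l"
  shows "\<phi> l = l"
proof (rule fixed_if_few[OF prime, of "{l \<in> L. I x l}"])
  show "\<phi> ` {l \<in> L. I x l} \<subseteq> {l \<in> L. I x l}"
    using incident[of x] assms \<phi>_closed by auto
  show "card {l \<in> L. I x l} < s + 1" using lines_through_point assms t_less_s by simp
qed (use assms finite_lines \<phi>_period in auto)

text \<open>The line through the two points is fixed, and apart from the given fixed point it has only $s$
  points, too few for an orbit.\<close>

lemma collinear_with_fixed_point_fixed:
  assumes "x \<in> P" "f x = x" "l \<in> L" "I x l" "y \<in> P" "I y l"
  shows "f y = y"
proof (cases "y = x")
  case False
  have fl: "\<phi> l = l" using line_through_fixed_point_fixed assms by blast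
  have card: "card ({z \<in> P. I z l} - {x}) = s" using assms points_on_line[of l] by simp
  show ?thesis
  proof (rule fixed_if_few[OF prime, of "{z \<in> P. I z l} - {x}"])
    show "f ` ({z \<in> P. I z l} - {x}) \<subseteq> {z \<in> P. I z l} - {x}"
      using incident[of _ l] f_inj[of _ x] f_closed assms fl by auto
  qed (use assms finite_points f_period card False in auto)
qed (use assms in simp)

text \<open>Every point is at distance at most two from a fixed point, so one fixed point would make the
  collineation trivial.\<close>

lemma no_fixed_point:
  assumes x: "x \<in> P"
  shows "f x \<noteq> x"
proof
  assume fx: "f x = x"
  have "f y = y" if y: "y \<in> P" for y
  proof -
    have "{l \<in> L. I x l} \<noteq> {}" using lines_through_point[OF x] by (metis Suc_eq_plus1 Zero_not_Suc card.empty)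
    then obtain l where l: "l \<in> L" "I x l" by blast
    show ?thesis
    proof (cases "I y l")
      case True
      then show ?thesis using collinear_with_fixed_point_fixed[OF x fx l y] by blast
    next
      case False
      then obtain z k where "z \<in> P" "k \<in> L" "I y k" "I z k" "I z l"
        using projection[OF y l(1)] by blast
      then show ?thesis
        using collinear_with_fixed_point_fixed[OF x fx l] collinear_with_fixed_point_fixed[of z k y] y
        by blast
    qed
  qed
  then show False using moved by blast
qed

definition fixed_lines :: "'b set" where
  "fixed_lines = {l \<in> L. \<phi> l = l}"

text \<open>The common point of two fixed lines would be a fixed point.\<close>

lemma disjoint_fixed_lines: "disjoint_lines fixed_lines"
  unfolding disjoint_lines_def
proof (intro conjI ballI impI)
  fix l m assume lm: "l \<in> fixed_lines" "m \<in> fixed_lines" "l \<noteq> m"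
  show "\<not> meets l m"
  proof
    assume "meets l m"
    then obtain x where x: "x \<in> P" "I x l" "I x m" by (auto simp: meets_def)
    then have "I (f x) l" "I (f x) m" using incident[of x l] incident[of x m] lm
      by (auto simp: fixed_lines_def)
    then have "f x = x"
      using at_most_one_point[of l m "f x" x] lm x f_closed by (auto simp: fixed_lines_def)
    then show False using no_fixed_point x by blast
  qed
qed (auto simp: fixed_lines_def)

text \<open>The quadrangle has $(t + 1)(s t + 1) = (s + 1) t (t + 1) + 1 - t^2$ lines. The congruence
  $F \equiv 1 - t^2$ is written with the natural number $t^2 - 1$ on the left.\<close>

lemma fixed_lines_cong: "s + 1 dvd card fixed_lines + (t\<^sup>2 - 1)"
proof -
  have "card L = card fixed_lines + card {l \<in> L. \<phi> l \<noteq> l}"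
    unfolding fixed_lines_def using finite_lines
    by (subst card_Un_disjoint[symmetric]) (auto intro!: arg_cong[where f = card])
  moreover have "s + 1 dvd card {l \<in> L. \<phi> l \<noteq> l}"
    by (rule prime_dvd_card_moved[OF prime finite_lines \<phi>_closed \<phi>_period])
  ultimately have "int (s + 1) dvd int (card L) - int (card fixed_lines)"
    by (metis add_diff_cancel_left' int_dvd_int_iff of_nat_add)
  then have "int (s + 1) dvd int (s + 1) * int (t * (t + 1)) -
      (int (card L) - int (card fixed_lines))"
    by (rule dvd_diff[OF dvd_triv_left])
  also have "\<dots> = int (card fixed_lines) + ((int t)\<^sup>2 - 1)"
    by (simp add: card_lines power2_eq_square algebra_simps)
  also have "\<dots> = int (card fixed_lines + (t\<^sup>2 - 1))"
  proof -
    have "1 \<le> t\<^sup>2" using t_pos by simp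
    then show ?thesis by (simp only: of_nat_add of_nat_diff of_nat_power of_nat_1)
  qed
  finally show ?thesis by (simp only: of_nat_dvd_iff)
qed

lemma fixed_lines_nonempty: "fixed_lines \<noteq> {}"
proof
  assume "fixed_lines = {}"
  then have "s + 1 dvd (t + 1) * (t - 1)"
    using fixed_lines_cong by (simp add: power2_eq_square algebra_simps)
  then have "s + 1 dvd t + 1 \<or> s + 1 dvd t - 1" using prime prime_dvd_mult_iff by blast
  then show False using t_less_s t_gt_1 by (auto dest!: dvd_imp_le)
qed

text \<open>The orbit \<open>B\<close> of the moved line \<open>k\<close> and the fixed lines meeting \<open>k\<close> form a grid: iterating the
  collineation carries the intersection of a fixed line with \<open>k\<close> to its intersection with any
  other line of the orbit. Lines of the orbit are disjoint, since a common point together with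
  their distinct points on \<open>k0\<close> would form a triangle.\<close>

lemma fixed_lines_on_transversal:
  assumes k: "k \<in> L" "\<phi> k \<noteq> k" and k0: "k0 \<in> fixed_lines" "meets k0 k"
  shows "(card {l \<in> fixed_lines. meets l k} - 1) * s \<le> t\<^sup>2"
proof (rule grid_bound)
  let ?A = "{l \<in> fixed_lines. meets l k}"
  define B where "B = (\<lambda>i. (\<phi> ^^ i) k) ` {..<s + 1}"
  have inj: "inj_on (\<lambda>i. (\<phi> ^^ i) k) {..<s + 1}"
    using iterates_distinct[OF prime \<phi>_period] k by blast
  have iter_fixed: "(\<phi> ^^ i) l = l" if "l \<in> fixed_lines" for i l
    using that by (intro funpow_fixed) (simp add: fixed_lines_def)
  have not_fixed: "(\<phi> ^^ i) k \<notin> fixed_lines" if "i < s + 1" for i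
  proof
    assume "(\<phi> ^^ i) k \<in> fixed_lines"
    then have "(\<phi> ^^ (s + 1 - i)) ((\<phi> ^^ i) k) = (\<phi> ^^ i) k" by (rule iter_fixed)
    moreover have "(\<phi> ^^ (s + 1 - i)) ((\<phi> ^^ i) k) = k"
      using \<phi>_period[OF k(1)] that by (metis comp_apply funpow_add le_add_diff_inverse2 less_imp_le)
    ultimately show False using \<open>(\<phi> ^^ i) k \<in> fixed_lines\<close> k by (simp add: fixed_lines_def)
  qed
  show "disjoint_lines ?A" using disjoint_fixed_lines by (auto simp: disjoint_lines_def)
  show "?A \<noteq> {}" using k0 by blast
  show "card B = s + 1" unfolding B_def using inj by (simp add: card_image)
  show "?A \<inter> B = {}" using not_fixed by (auto simp: B_def)
  have meets_iter: "\<exists>x\<in>P. I x l \<and> I x k \<and> I ((f ^^ i) x) l \<and> I ((f ^^ i) x) ((\<phi> ^^ i) k)"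
    if "l \<in> fixed_lines" "meets l k" for l i
    using that iter_incident[of _ l i] iter_incident[of _ k i] iter_fixed[of l i] k(1)
    by (fastforce simp: meets_def fixed_lines_def)
  show "meets l b" if "l \<in> ?A" "b \<in> B" for l b
    using that meets_iter[of l] f_iter_closed by (fastforce simp: B_def meets_def)
  show "disjoint_lines B"
    unfolding disjoint_lines_def
  proof (intro conjI ballI impI)
    show "B \<subseteq> L" using \<phi>_iter_closed[OF k(1)] by (auto simp: B_def)
    fix b b' assume bb: "b \<in> B" "b' \<in> B" "b \<noteq> b'"
    obtain i j where ij: "i < s + 1" "b = (\<phi> ^^ i) k" "j < s + 1" "b' = (\<phi> ^^ j) k"
      using bb by (auto simp: B_def)
    obtain x where x: "x \<in> P" "I x k0" "I x k" using k0 by (auto simp: meets_def)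
    have k0L: "k0 \<in> L" using k0 by (simp add: fixed_lines_def)
    define y z where "y = (f ^^ i) x" and "z = (f ^^ j) x"
    have yz: "y \<in> P" "z \<in> P" "I y k0" "I z k0" "I y b" "I z b'"
      using f_iter_closed[OF x(1)] iter_incident[OF x(1) k0L x(2)] iter_fixed[OF k0(1)]
        iter_incident[OF x(1) k(1) x(3)] by (auto simp: y_def z_def ij)
    have "y \<noteq> z"
    proof -
      have "inj_on (\<lambda>i. (f ^^ i) x) {..<s + 1}"
        using iterates_distinct[OF prime f_period] no_fixed_point x by blast
      then show ?thesis using ij bb by (auto simp: inj_on_def y_def z_def)
    qed
    have L: "b \<in> L" "b' \<in> L" using ij \<phi>_iter_closed[OF k(1)] by auto
    have ne: "b \<noteq> k0" "b' \<noteq> k0" using ij not_fixed k0 by auto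
    show "\<not> meets b b'"
    proof
      assume "meets b b'"
      then obtain w where w: "w \<in> P" "I w b" "I w b'" by (auto simp: meets_def)
      show False
      proof (cases "I w k0")
        case True
        then have "w = y" "w = z"
          using at_most_one_point[of b k0 w y] at_most_one_point[of b' k0 w z] w yz L ne k0L by auto
        then show False using \<open>y \<noteq> z\<close> by simp
      next
        case False
        then show False
          using no_triangle(2)[of w k0 b y b' z] w yz L k0L \<open>y \<noteq> z\<close> by blast
      qed
    qed
  qed
qed

text \<open>Project the fixed lines to a point \<open>x\<close> of one fixed line \<open>l\<close>: each fixed line other than \<open>l\<close> is met by
  one of the $t$ further lines through \<open>x\<close>, and each of these meets at most $n$ of them.\<close>

lemma card_fixed_lines_le:
  assumes n: "\<And>a. a * s \<le> t\<^sup>2 \<Longrightarrow> a \<le> n"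
  shows "card fixed_lines \<le> 1 + t * n"
proof -
  obtain l where l: "l \<in> fixed_lines" using fixed_lines_nonempty by blast
  then have lL: "l \<in> L" "\<phi> l = l" by (auto simp: fixed_lines_def)
  have "{x \<in> P. I x l} \<noteq> {}" using points_on_line[OF lL(1)] by (metis Suc_eq_plus1 Zero_not_Suc card.empty)
  then obtain x where x: "x \<in> P" "I x l" by blast
  define K where "K = {k \<in> L. I x k} - {l}"
  define F where "F k = {m \<in> fixed_lines. meets m k} - {l}" for k
  have fin: "finite K" "finite fixed_lines" using finite_lines by (auto simp: K_def fixed_lines_def)
  have cK: "card K = t" using lines_through_point[OF x(1)] lL x by (simp add: K_def)
  have "card (F k) \<le> n" if k: "k \<in> K" for k
  proof -
    have lk: "meets l k" "k \<in> L" using k x by (auto simp: K_def meets_def)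
    then have "k \<notin> fixed_lines"
      using k l disjoint_fixed_lines by (auto simp: disjoint_lines_def K_def)
    then have "(card {m \<in> fixed_lines. meets m k} - 1) * s \<le> t\<^sup>2"
      using fixed_lines_on_transversal[of k l] lk l by (simp add: fixed_lines_def)
    moreover have "card (F k) = card {m \<in> fixed_lines. meets m k} - 1"
      using l lk by (simp add: F_def)
    ultimately show ?thesis using n by simp
  qed
  then have "(\<Sum>k\<in>K. card (F k)) \<le> t * n" using sum_bounded_above[of K "\<lambda>k. card (F k)" n] cK by simp
  moreover have "fixed_lines - {l} \<subseteq> (\<Union>k\<in>K. F k)"
  proof
    fix m assume m: "m \<in> fixed_lines - {l}"
    then have mL: "m \<in> L" by (simp add: fixed_lines_def)
    have disj: "\<not> meets l m" using m l disjoint_fixed_lines by (auto simp: disjoint_lines_def)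
    then have "\<not> I x m" using x by (auto simp: meets_def)
    then obtain y k where yk: "y \<in> P" "k \<in> L" "I x k" "I y k" "I y m"
      using projection[OF x(1) mL] by blast
    then have "k \<noteq> l" using disj by (auto simp: meets_def)
    then show "m \<in> (\<Union>k\<in>K. F k)" using yk m by (auto simp: K_def F_def meets_def)
  qed
  then have "card (fixed_lines - {l}) \<le> card (\<Union>k\<in>K. F k)"
    using fin by (intro card_mono) (auto simp: F_def)
  moreover have "card (\<Union>k\<in>K. F k) \<le> (\<Sum>k\<in>K. card (F k))" using fin by (intro card_UN_le)
  ultimately show ?thesis using l fin by (simp add: card_Diff_singleton)
qed

end

section \<open>Automorphisms as collineations\<close>

lemma finite_carrier_aut_group:
  assumes "finite P"
  shows "finite (carrier (aut_group P L I))"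
proof (rule finite_subset)
  show "carrier (aut_group P L I) \<subseteq> P \<rightarrow>\<^sub>E P"
    by (auto simp: aut_group_def Bij_def bij_betw_def PiE_def)
  show "finite (P \<rightarrow>\<^sub>E P)" using assms by (intro finite_PiE)
qed

lemma aut_group_pow_apply:
  assumes P: "finite P" and g: "g \<in> carrier (aut_group P L I)" and x: "x \<in> P"
  shows "(g [^]\<^bsub>aut_group P L I\<^esub> n) x = (g ^^ n) x"
  using x
proof (induction n arbitrary: x)
  case 0
  then show ?case by (simp add: aut_group_def BijGroup_def)
next
  case (Suc n)
  interpret G: group "aut_group P L I" using group_aut_group[OF P] .
  let ?h = "g [^]\<^bsub>aut_group P L I\<^esub> n"
  have B: "?h \<in> Bij P" "g \<in> Bij P"
    using G.nat_pow_closed[OF g, of n] g by (auto simp: aut_group_def)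
  then have "g x \<in> P" using Suc.prems by (auto simp: Bij_def bij_betw_def)
  have "a \<otimes>\<^bsub>aut_group P L I\<^esub> b = compose P a b" if "a \<in> Bij P" "b \<in> Bij P" for a b
    using that by (simp add: aut_group_def BijGroup_def)
  then have "g [^]\<^bsub>aut_group P L I\<^esub> Suc n = compose P ?h g"
    unfolding nat_pow_Suc using B by blast
  then have "(g [^]\<^bsub>aut_group P L I\<^esub> Suc n) x = ?h (g x)"
    using Suc.prems by (simp add: compose_eq)
  also have "\<dots> = (g ^^ n) (g x)" using Suc.IH \<open>g x \<in> P\<close> .
  also have "\<dots> = (g ^^ Suc n) x" by (simp only: funpow_Suc_right o_apply)
  finally show ?case .
qed

context thick_generalized_quadrangle
begin

lemma two_points_on_line:
  assumes "l \<in> L"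
  obtains x y where "x \<in> P" "y \<in> P" "x \<noteq> y" "I x l" "I y l"
proof -
  have "\<not> card {x \<in> P. I x l} \<le> Suc 0" using points_on_line[OF assms] s_pos by simp
  then show ?thesis using that finite_points by (auto simp: card_le_Suc0_iff_eq)
qed

text \<open>The images of the points of a line are pairwise collinear. If they were not on one line, three
  of them would form a triangle.\<close>

lemma image_of_line:
  assumes g: "g \<in> carrier (aut_group P L I)" and l: "l \<in> L"
  shows "\<exists>m\<in>L. \<forall>x\<in>P. I x l \<longrightarrow> I (g x) m"
proof -
  have gP: "g x \<in> P" if "x \<in> P" for x
    using g that by (auto simp: aut_group_def Bij_def bij_betw_def)
  have inj: "inj_on g P" using g by (auto simp: aut_group_def Bij_def bij_betw_def)
  have col: "\<exists>m\<in>L. I (g x) m \<and> I (g y) m" if "x \<in> P" "y \<in> P" "I x l" "I y l" for x y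
    using g l that unfolding aut_group_def collinear_def by auto
  obtain x y where xy: "x \<in> P" "y \<in> P" "x \<noteq> y" "I x l" "I y l" using two_points_on_line[OF l] .
  obtain m where m: "m \<in> L" "I (g x) m" "I (g y) m" using col[of x y] xy by blast
  have "I (g z) m" if z: "z \<in> P" "I z l" for z
  proof (rule ccontr)
    assume off: "\<not> I (g z) m"
    obtain k where k: "k \<in> L" "I (g z) k" "I (g x) k" using col[of z x] z xy by blast
    obtain k' where k': "k' \<in> L" "I (g z) k'" "I (g y) k'" using col[of z y] z xy by blast
    have "g x = g y"
      using no_triangle(2)[of "g z" m k "g x" k' "g y"] off k k' m gP xy z by blast
    then show False using inj xy by (auto simp: inj_on_def)
  qed
  then show ?thesis using m by blast
qed

text \<open>A choice of image lines inherits the period of the automorphism because a line is determined by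
  two of its points.\<close>

lemma aut_induces_line_map:
  assumes g: "g \<in> carrier (aut_group P L I)" and gn: "g [^]\<^bsub>aut_group P L I\<^esub> n = \<one>\<^bsub>aut_group P L I\<^esub>"
  obtains \<phi> where "\<phi> ` L \<subseteq> L" "\<And>x l. \<lbrakk>x \<in> P; l \<in> L; I x l\<rbrakk> \<Longrightarrow> I (g x) (\<phi> l)"
    "\<And>l. l \<in> L \<Longrightarrow> (\<phi> ^^ n) l = l"
proof -
  have "\<forall>l\<in>L. \<exists>m. m \<in> L \<and> (\<forall>x\<in>P. I x l \<longrightarrow> I (g x) m)" using image_of_line[OF g] by blast
  then obtain \<phi> where \<phi>: "\<And>l. l \<in> L \<Longrightarrow> \<phi> l \<in> L \<and> (\<forall>x\<in>P. I x l \<longrightarrow> I (g x) (\<phi> l))" by metis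
  have gP: "g ` P \<subseteq> P" using g by (auto simp: aut_group_def Bij_def bij_betw_def)
  have \<phi>L: "\<phi> ` L \<subseteq> L" using \<phi> by blast
  have period: "(g ^^ n) x = x" if "x \<in> P" for x
    using aut_group_pow_apply[OF finite_points g that, of n] gn that
    by (simp add: aut_group_def BijGroup_def)
  have iter: "I ((g ^^ i) x) ((\<phi> ^^ i) l)" if "x \<in> P" "l \<in> L" "I x l" for x l i
    using that by (induction i) (auto simp: \<phi> funpow_closed[OF gP] funpow_closed[OF \<phi>L])
  have "(\<phi> ^^ n) l = l" if l: "l \<in> L" for l
  proof -
    obtain x y where xy: "x \<in> P" "y \<in> P" "x \<noteq> y" "I x l" "I y l" using two_points_on_line[OF l] .
    then have "I x ((\<phi> ^^ n) l)" "I y ((\<phi> ^^ n) l)"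
      using iter[of x l n] iter[of y l n] period l by auto
    then show ?thesis
      using at_most_one_line[of x y "(\<phi> ^^ n) l" l] xy l funpow_closed[OF \<phi>L l] by simp
  qed
  with \<phi> \<phi>L show ?thesis by (intro that[of \<phi>]) simp_all
qed

text \<open>The hypotheses \<open>lower\<close> and \<open>upper\<close> are the two inequalities of the theorem with denominators
  cleared. The number of fixed lines of a nontrivial automorphism would put a multiple of $s + 1$
  strictly between the consecutive multiples $n (s + 1)$ and $(n + 1)(s + 1)$.\<close>

lemma aut_prime_period_trivial:
  assumes prime: "prime (s + 1)" and n: "n > 0"
    and lower: "t\<^sup>2 + (n + 1) * t \<le> (n + 1) * (s + 1)" and upper: "n * (s + 1) < t\<^sup>2"
    and g: "g \<in> carrier (aut_group P L I)"
    and period: "g [^]\<^bsub>aut_group P L I\<^esub> (s + 1) = \<one>\<^bsub>aut_group P L I\<^esub>"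
  shows "g = \<one>\<^bsub>aut_group P L I\<^esub>"
proof (rule ccontr)
  assume ne: "g \<noteq> \<one>\<^bsub>aut_group P L I\<^esub>"
  have t_less_s: "t < s"
  proof (rule ccontr)
    assume "\<not> t < s"
    moreover have "(n + 1) * t < (n + 1) * (s + 1)"
      using lower zero_less_power[OF t_pos, of 2] by linarith
    then have "t < s + 1" by (simp only: mult_less_cancel1)
    ultimately have "s = t" by simp
    then have "t\<^sup>2 \<le> n + 1" "n * t + n < t\<^sup>2" using lower upper by (auto simp: algebra_simps)
    then have "n * t < 1" by linarith
    then show False using n t_pos by simp
  qed
  have "g \<in> extensional P" and gP: "g ` P \<subseteq> P"
    using g by (auto simp: aut_group_def Bij_def bij_betw_def)
  have moved: "\<exists>x\<in>P. g x \<noteq> x"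
  proof (rule ccontr)
    assume "\<not> (\<exists>x\<in>P. g x \<noteq> x)"
    then have "g = (\<lambda>x\<in>P. x)" using \<open>g \<in> extensional P\<close> by (auto simp: extensional_def fun_eq_iff)
    then show False using ne by (simp add: aut_group_def BijGroup_def)
  qed
  obtain \<phi> where \<phi>: "\<phi> ` L \<subseteq> L" "\<And>x l. \<lbrakk>x \<in> P; l \<in> L; I x l\<rbrakk> \<Longrightarrow> I (g x) (\<phi> l)"
    "\<And>l. l \<in> L \<Longrightarrow> (\<phi> ^^ (s + 1)) l = l"
    using aut_induces_line_map[OF g period] by blast
  have g_period: "(g ^^ (s + 1)) x = x" if "x \<in> P" for x
    using aut_group_pow_apply[OF finite_points g that, of "s + 1"] period that
    by (simp add: aut_group_def BijGroup_def del: funpow.simps nat_pow_Suc)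
  interpret prime_collineation P L I s t g \<phi>
    by unfold_locales (fact prime gP \<phi> g_period moved t_less_s)+
  have "a \<le> n" if "a * s \<le> t\<^sup>2" for a
  proof (rule ccontr)
    assume "\<not> a \<le> n"
    then have "(n + 1) * s \<le> a * s" by (intro mult_right_mono) simp_all
    moreover have "(n + 1) * 2 \<le> (n + 1) * t" using t_gt_1 by (intro mult_left_mono) simp_all
    ultimately show False using lower that by (simp add: algebra_simps)
  qed
  then have le: "card fixed_lines \<le> 1 + t * n" by (rule card_fixed_lines_le)
  have ge: "card fixed_lines \<ge> 1"
    using fixed_lines_nonempty finite_lines by (simp add: Suc_le_eq card_gt_0_iff fixed_lines_def)
  obtain q where q: "card fixed_lines + (t\<^sup>2 - 1) = (s + 1) * q"
    using fixed_lines_cong by (auto elim: dvdE)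
  have t2: "t\<^sup>2 \<ge> 1" using t_pos by simp
  have "(s + 1) * n < (s + 1) * q" using q ge t2 upper by (simp add: algebra_simps)
  moreover have "(s + 1) * q < (s + 1) * (n + 1)"
    using q le t2 lower t_pos by (simp add: algebra_simps)
  ultimately have "n < q" "q < n + 1" by (simp_all only: mult_less_cancel1)
  then show False by simp
qed

end

section \<open>Transitive groups\<close>

text \<open>The orbit-stabilizer theorem makes $p$ divide the group order; Sylow's theorem with exponent one
  then plays the part of Cauchy's theorem.\<close>

lemma transitive_group_has_element_of_prime_order:
  assumes G: "group G" and fin: "finite (carrier G)" and tr: "transitive_action G E \<psi>"
    and E: "finite E" "E \<noteq> {}" and p: "prime p" "p dvd card E"
  shows "\<exists>g\<in>carrier G. g \<noteq> \<one>\<^bsub>G\<^esub> \<and> g [^]\<^bsub>G\<^esub> p = \<one>\<^bsub>G\<^esub>"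
proof -
  interpret G: group G by (rule G)
  interpret tr: transitive_action G E \<psi> by (rule tr)
  obtain x where x: "x \<in> E" using E by blast
  have "orbit G \<psi> x = E"
  proof (rule equalityI; rule subsetI)
    show "y \<in> E" if "y \<in> orbit G \<psi> x" for y
      using that tr.element_image[OF _ x] by (auto simp: orbit_def)
    show "y \<in> orbit G \<psi> x" if "y \<in> E" for y
      using tr.unique_orbit[OF x that] by (auto simp: orbit_def)
  qed
  then have "p dvd order G"
    using tr.orbit_stabilizer_theorem[OF x] p(2) by (metis dvd_mult2)
  then obtain m where "order G = p ^ 1 * m" by (auto elim: dvdE)
  then obtain K where K: "subgroup K G" "card K = p ^ 1"
    using sylow_thm[OF p(1) G _ fin] by blast
  interpret K: group "G\<lparr>carrier := K\<rparr>" using G.subgroup_imp_group[OF K(1)] .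
  have "card K > 1" using K p prime_gt_1_nat by simp
  then have "\<not> K \<subseteq> {\<one>\<^bsub>G\<^esub>}" using card_mono[of "{\<one>\<^bsub>G\<^esub>}" K] by auto
  then obtain g where g: "g \<in> K" "g \<noteq> \<one>\<^bsub>G\<^esub>" by blast
  have "g [^]\<^bsub>G\<lparr>carrier := K\<rparr>\<^esub> order (G\<lparr>carrier := K\<rparr>) = \<one>\<^bsub>G\<lparr>carrier := K\<rparr>\<^esub>"
    using K.pow_order_eq_1[of g] g by simp
  then have "g [^]\<^bsub>G\<^esub> p = \<one>\<^bsub>G\<^esub>"
    using K(2) G.nat_pow_consistent[of g p K] by (simp add: order_def)
  then show ?thesis using g subgroup.subset[OF K(1)] by blast
qed

theorem corollary1p4:
  fixes P :: "'p set" and L :: "'l set" and I :: "'p \<Rightarrow> 'l \<Rightarrow> bool" and s t :: nat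
  assumes "thick_generalized_quadrangle P L I s t"
    and "prime (s + 1)"
    and "\<exists>n::nat. n > 0 \<and>
      (real t)\<^sup>2 / (real n + 1) + real t \<le> real s + 1 \<and> real s + 1 < (real t)\<^sup>2 / real n"
  shows "\<not> (\<exists>g \<in> carrier (aut_group P L I). group.ord (aut_group P L I) g = s + 1) \<and>
    \<not> (\<exists>H. subgroup H (aut_group P L I) \<and>
         transitive_action ((aut_group P L I)\<lparr>carrier := H\<rparr>) P (\<lambda>g. g))"
proof -
  interpret thick_generalized_quadrangle P L I s t by (rule assms(1))
  interpret G: group "aut_group P L I" using group_aut_group[OF finite_points] .
  obtain n :: nat where n: "n > 0"
    and nl: "(real t)\<^sup>2 / (real n + 1) + real t \<le> real s + 1"
    and nu: "real s + 1 < (real t)\<^sup>2 / real n"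
    using assms(3) by blast
  have "((real t)\<^sup>2 / (real n + 1) + real t) * (real n + 1) \<le> (real s + 1) * (real n + 1)"
    using nl by (intro mult_right_mono) auto
  then have "(real t)\<^sup>2 + (real n + 1) * real t \<le> (real n + 1) * (real s + 1)"
  proof -
    have "((real t)\<^sup>2 / (real n + 1) + real t) * (real n + 1) = (real t)\<^sup>2 + (real n + 1) * real t"
      by (simp add: field_simps)
    with \<open>_ \<le> (real s + 1) * (real n + 1)\<close> show ?thesis by (simp only: mult.commute)
  qed
  then have "real (t\<^sup>2 + (n + 1) * t) \<le> real ((n + 1) * (s + 1))"
    by (simp only: of_nat_add of_nat_mult of_nat_power of_nat_1)
  then have lower: "t\<^sup>2 + (n + 1) * t \<le> (n + 1) * (s + 1)" by (simp only: of_nat_le_iff)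
  have "real n * (real s + 1) < (real t)\<^sup>2" using nu n by (simp add: field_simps)
  then have "real (n * (s + 1)) < real (t\<^sup>2)"
    by (simp only: of_nat_add of_nat_mult of_nat_power of_nat_1)
  then have upper: "n * (s + 1) < t\<^sup>2" by (simp only: of_nat_less_iff)
  note trivial = aut_prime_period_trivial[OF assms(2) n lower upper]
  show ?thesis
  proof (intro conjI notI)
    assume "\<exists>g\<in>carrier (aut_group P L I). G.ord g = s + 1"
    then obtain g where g: "g \<in> carrier (aut_group P L I)" "G.ord g = s + 1" by blast
    then have "g = \<one>\<^bsub>aut_group P L I\<^esub>" using trivial[OF g(1)] G.pow_ord_eq_1[OF g(1)] by simp
    then show False using g s_pos by simp
  next
    assume "\<exists>H. subgroup H (aut_group P L I) \<and>
      transitive_action ((aut_group P L I)\<lparr>carrier := H\<rparr>) P (\<lambda>g. g)"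
    then obtain H where H: "subgroup H (aut_group P L I)"
      and tr: "transitive_action ((aut_group P L I)\<lparr>carrier := H\<rparr>) P (\<lambda>g. g)" by blast
    have HG: "H \<subseteq> carrier (aut_group P L I)" using subgroup.subset[OF H] .
    then have "finite H" using finite_carrier_aut_group[OF finite_points] finite_subset by blast
    moreover have "s + 1 dvd card P" by (simp only: card_points dvd_triv_left)
    ultimately obtain g where "g \<in> H" "g \<noteq> \<one>\<^bsub>aut_group P L I\<^esub>"
      "g [^]\<^bsub>(aut_group P L I)\<lparr>carrier := H\<rparr>\<^esub> (s + 1) = \<one>\<^bsub>aut_group P L I\<^esub>"
      using transitive_group_has_element_of_prime_order
        [OF G.subgroup_imp_group[OF H] _ tr finite_points points_nonempty assms(2)] by auto
    then show False using trivial[of g] HG G.nat_pow_consistent[of g "s + 1" H] by auto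
  qed
qed

end
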